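(* Let $\vec\alpha\,F$ be an $n$-ary BNF and $\sim$ a type-polymorphic family of relations on $\vec\alpha\,F$ satisfying, at every type instance: (E) $\sim$ is an equivalence relation; (WI) for all families $\mathcal A_1,\dots,\mathcal A_n$ with $\mathcal A_i\neq\emptyset$ and $\bigcap\mathcal A_i\neq\emptyset$ for all $i$, $\bigcap\{[F_{\mathrm{in}}\,\vec A]_\sim\mid\forall i.\ A_i\in\mathcal A_i\}\subseteq\big[\bigcap\{F_{\mathrm{in}}\,\vec A\mid\forall i.\ A_i\in\mathcal A_i\}\big]_\sim$; (WP) for all relations $\vec R,\vec S$ with $R_i\bullet S_i\neq\emptyset$ for all $i$, $\mathrm{rel}_F\,\vec R\bullet{\sim}\bullet\mathrm{rel}_F\,\vec S\subseteq{\sim}\bullet\mathrm{rel}_F\,\overrightarrow{(R\bullet S)}\bullet{\sim}$. Then the quotient type $\vec\alpha\,Q=\vec\alpha\,F/{\sim}$ is a BNF (with some infinite cardinal bound) with mapper $\mathrm{map}_Q\,\vec f\,[x]_\sim=[\mathrm{map}_F\,\vec f\,x]_\sim$, setters $$\mathrm{set}_{Q,i}\,[x]_\sim=\bigcap_{y\in[\mathrm{map}_F\,\vec{\mathfrak e}\,x]_\sim}\{a\mid\mathfrak e\,a\in\mathrm{set}_{F,i}\,y\},$$ and relator given by $([x]_\sim,[y]_\sim)\in\mathrm{rel}_Q\,\vec R\iff(\mathrm{map}_F\,\vec{\mathfrak e}\,x,\mathrm{map}_F\,\vec{\mathfrak e}\,y)\in({\sim}\bullet\mathrm{rel}_F\,\overrightarrow{(\mathrm{rel}_{\mathsf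 1+}\,R)}\bullet{\sim})$.
   Context: HOL setting (all types non-empty); vector notation $\vec x=x_1,\dots,x_n$ with synchronized indices. Relations are identified with sets of pairs and $\bullet$ is relation composition. An $n$-ary BNF is a type constructor $\vec\alpha\,F$ with polymorphic mapper $\mathrm{map}_F::(\alpha_1\to\beta_1)\to\cdots\to(\alpha_n\to\beta_n)\to\vec\alpha\,F\to\vec\beta\,F$, setters $\mathrm{set}_{F,i}::\vec\alpha\,F\to\alpha_i\ \mathrm{set}$, an infinite cardinal bound $\mathrm{bd}_F$, and relator $\mathrm{rel}_F$, satisfying: $\mathrm{map}_F\,\vec{\mathrm{id}}=\mathrm{id}$; $\mathrm{map}_F\,\vec g\circ\mathrm{map}_F\,\vec f=\mathrm{map}_F\,\overrightarrow{(g\circ f)}$; $\mathrm{set}_{F,i}(\mathrm{map}_F\,\vec f\,x)=f_i\langle\mathrm{set}_{F,i}\,x\rangle$ (image); if $f_i z=g_i z$ for all $i$ and $z\in\mathrm{set}_{F,i}\,x$ then $\mathrm{map}_F\,\vec f\,x=\mathrm{map}_F\,\vec g\,x$; $|\mathrm{set}_{F,i}\,x|\le\mathrm{bd}_F$; $(x,y)\in\mathrm{rel}_F\,\vec R$ iff some $z$ has $\mathrm{set}_{F,i}\,z\subseteq R_i$ for all $i$, $\mathrm{map}_F\,\overrightarrow{\mathrm{fst}}\,z=x$, $\mathrm{map}_F\,\overrightarrow{\mathrm{snd}}\,z=y$; and $\mathrm{rel}_F\,\vec R\bullet\mathrm{rel}_F\,\vec S\subseteq\mathrm{rel}_F\,\overrightarrow{(R\bullet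 S)}$. Notation: $F_{\mathrm{in}}\,\vec A=\{x\mid\forall i.\ \mathrm{set}_{F,i}\,x\subseteq A_i\}$; $[x]_\sim=\{y\mid x\sim y\}$, $[A]_\sim=\{[x]_\sim\mid x\in A\}$; $\mathsf 1+\alpha$ is the sum of the unit type and $\alpha$, with $\circledast$ the left injection of the unit element and $\mathfrak e::\alpha\to\mathsf 1+\alpha$ the right injection; $\mathrm{rel}_{\mathsf 1+}\,R=\{(\circledast,\circledast)\}\cup\{(\mathfrak e\,a,\mathfrak e\,b)\mid(a,b)\in R\}$. The quotient type $\vec\alpha\,Q$ is (isomorphic to) the set of $\sim$-equivalence classes of $\vec\alpha\,F$. *)

theory Defs
  imports Main
begin

unbundle cardinal_syntax

text \<open>
  HOL has no variables for type constructors, and a theorem cannot quantify over all type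
  instances of one.  An \<open>n\<close>-ary type constructor is therefore modelled by its action on the
  nonempty subsets of a universe, which play the role of the types.  The index type \<open>'n\<close>
  enumerates the \<open>n\<close> arguments; a family \<open>A :: 'n \<Rightarrow> 'a univ set\<close> of nonempty sets is a tuple of
  argument types, and \<open>F A\<close> is the type (again a nonempty set) obtained by applying the
  constructor to it.  Nothing relates \<open>F A\<close> and \<open>F B\<close> for different families \<open>A\<close> and \<open>B\<close>.

  The universe is freely generated over an arbitrary type \<open>'a\<close>, which makes the class of types
  closed under the two constructions needed below, products and \<open>1 + _\<close>.
\<close>

datatype 'a univ =
    Base 'a
  | Pr (fst_univ: "'a univ") (snd_univ: "'a univ")
  | Star
  | Emb "'a univ"

type_synonym ('n, 'a) types = "'n \<Rightarrow> 'a univ set"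

definition is_types :: "('n, 'a) types \<Rightarrow> bool" where
  "is_types A \<longleftrightarrow> (\<forall>i. A i \<noteq> {})"

definition prod_types :: "('n, 'a) types \<Rightarrow> ('n, 'a) types \<Rightarrow> ('n, 'a) types" where
  "prod_types A B = (\<lambda>i. {Pr a b | a b. a \<in> A i \<and> b \<in> B i})"

definition one_plus :: "('n, 'a) types \<Rightarrow> ('n, 'a) types" where
  "one_plus A = (\<lambda>i. insert Star (Emb ` A i))"

definition rel_one_plus :: "'a univ rel \<Rightarrow> 'a univ rel" where
  "rel_one_plus R = insert (Star, Star) {(Emb a, Emb b) | a b. (a, b) \<in> R}"

definition funs_between :: "('n, 'a) types \<Rightarrow> ('n, 'a) types \<Rightarrow> ('n \<Rightarrow> 'a univ \<Rightarrow> 'a univ) \<Rightarrow> bool" where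
  "funs_between A B f \<longleftrightarrow> (\<forall>i. f i ` A i \<subseteq> B i)"

definition rels_between :: "('n, 'a) types \<Rightarrow> ('n, 'a) types \<Rightarrow> ('n \<Rightarrow> 'a univ rel) \<Rightarrow> bool" where
  "rels_between A B R \<longleftrightarrow> (\<forall>i. R i \<subseteq> A i \<times> B i)"

text \<open>
  The type arguments of a polymorphic constant become explicit: \<open>map\<^sub>F\<close> and \<open>rel\<^sub>F\<close> take source
  and target families, \<open>set\<^sub>F\<close> takes one family.  The assumptions whose names end in
  \<open>_type\<close>, and \<open>inhabited\<close>, express the typing discipline of HOL.  In \<open>in_rel\<close>, the pairs in
  \<open>R i\<close> are encoded by \<open>Pr\<close>, since they occur as atoms of \<open>z\<close>.
\<close>

locale nary_bnf =
  fixes F :: "('n::finite, 'a) types \<Rightarrow> 'x set"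
    and mapF :: "('n, 'a) types \<Rightarrow> ('n, 'a) types \<Rightarrow> ('n \<Rightarrow> 'a univ \<Rightarrow> 'a univ) \<Rightarrow> 'x \<Rightarrow> 'x"
    and setF :: "('n, 'a) types \<Rightarrow> 'n \<Rightarrow> 'x \<Rightarrow> 'a univ set"
    and bdF :: "'k rel"
    and relF :: "('n, 'a) types \<Rightarrow> ('n, 'a) types \<Rightarrow> ('n \<Rightarrow> 'a univ rel) \<Rightarrow> 'x rel"
  assumes inhabited: "is_types A \<Longrightarrow> F A \<noteq> {}"
    and map_type: "\<lbrakk>is_types A; is_types B; funs_between A B f; x \<in> F A\<rbrakk> \<Longrightarrow> mapF A B f x \<in> F B"
    and set_type: "\<lbrakk>is_types A; x \<in> F A\<rbrakk> \<Longrightarrow> setF A i x \<subseteq> A i"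
    and rel_type: "\<lbrakk>is_types A; is_types B; rels_between A B R\<rbrakk> \<Longrightarrow> relF A B R \<subseteq> F A \<times> F B"
    and map_id: "\<lbrakk>is_types A; x \<in> F A\<rbrakk> \<Longrightarrow> mapF A A (\<lambda>i. id) x = x"
    and map_comp: "\<lbrakk>is_types A; is_types B; is_types C; funs_between A B f; funs_between B C g; x \<in> F A\<rbrakk>
      \<Longrightarrow> mapF B C g (mapF A B f x) = mapF A C (\<lambda>i. g i \<circ> f i) x"
    and set_map: "\<lbrakk>is_types A; is_types B; funs_between A B f; x \<in> F A\<rbrakk>
      \<Longrightarrow> setF B i (mapF A B f x) = f i ` setF A i x"
    and map_cong: "\<lbrakk>is_types A; is_types B; funs_between A B f; funs_between A B g; x \<in> F A;
        \<forall>i. \<forall>z\<in>setF A i x. f i z = g i z\<rbrakk>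
      \<Longrightarrow> mapF A B f x = mapF A B g x"
    and bd_Card_order: "Card_order bdF"
    and bd_cinfinite: "cinfinite bdF"
    and set_bd: "\<lbrakk>is_types A; x \<in> F A\<rbrakk> \<Longrightarrow> |setF A i x| \<le>o bdF"
    and in_rel: "\<lbrakk>is_types A; is_types B; rels_between A B R; x \<in> F A; y \<in> F B\<rbrakk>
      \<Longrightarrow> (x, y) \<in> relF A B R \<longleftrightarrow>
        (\<exists>z\<in>F (prod_types A B).
          (\<forall>i. setF (prod_types A B) i z \<subseteq> {Pr a b | a b. (a, b) \<in> R i}) \<and>
          mapF (prod_types A B) A (\<lambda>i. fst_univ) z = x \<and>
          mapF (prod_types A B) B (\<lambda>i. snd_univ) z = y)"
    and rel_comp: "\<lbrakk>is_types A; is_types B; is_types C; rels_between A B R; rels_between B C S\<rbrakk>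
      \<Longrightarrow> relF A B R O relF B C S \<subseteq> relF A C (\<lambda>i. R i O S i)"

definition F_in ::
  "(('n, 'a) types \<Rightarrow> 'x set) \<Rightarrow> (('n, 'a) types \<Rightarrow> 'n \<Rightarrow> 'x \<Rightarrow> 'a univ set)
    \<Rightarrow> ('n, 'a) types \<Rightarrow> ('n \<Rightarrow> 'a univ set) \<Rightarrow> 'x set" where
  "F_in F setF T A = {x \<in> F T. \<forall>i. setF T i x \<subseteq> A i}"

end

theory Submission
  imports Defs
begin

text \<open>
  (WP) for functional relations makes \<open>\<sim>\<close> compatible with \<open>map\<^sub>F\<close>, and for subidentities it makes
  the classes of the sets \<open>F\<^sub>i\<^sub>n A\<close> closed under binary intersections, as long as all
  \<open>A\<^sub>i \<inter> B\<^sub>i\<close> are nonempty; over \<open>1 + \<alpha>\<close> the extra point guarantees this.  Together with (WI),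
  the class of \<open>map\<^sub>F e x\<close> therefore has a representative whose atoms, apart from the extra point,
  are exactly those of \<open>set\<^sub>Q [x]\<close>.  Computing with this representative, and returning from
  \<open>1 + \<alpha>\<close> to \<open>\<alpha>\<close> by sending the extra point to some default value, gives the BNF axioms.
\<close>

section \<open>Functions and relations on extended types and products\<close>

definition map_one_plus :: "('a univ \<Rightarrow> 'a univ) \<Rightarrow> 'a univ \<Rightarrow> 'a univ" where
  "map_one_plus f u = (case u of Emb a \<Rightarrow> Emb (f a) | _ \<Rightarrow> Star)"

definition from_one_plus :: "'a univ \<Rightarrow> 'a univ \<Rightarrow> 'a univ" where
  "from_one_plus c u = (case u of Emb a \<Rightarrow> a | _ \<Rightarrow> c)"

lemma map_one_plus_simps [simp]:
  "map_one_plus f Star = Star" "map_one_plus f (Emb a) = Emb (f a)"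
  by (simp_all add: map_one_plus_def)

lemma from_one_plus_simps [simp]:
  "from_one_plus c Star = c" "from_one_plus c (Emb a) = a"
  by (simp_all add: from_one_plus_def)

lemma is_types_one_plus [simp]: "is_types (one_plus A)"
  by (simp add: is_types_def one_plus_def)

lemma is_types_prod_types: "is_types A \<Longrightarrow> is_types B \<Longrightarrow> is_types (prod_types A B)"
  by (fastforce simp: is_types_def prod_types_def)

lemma funs_between_id: "funs_between A A (\<lambda>i. id)"
  by (simp add: funs_between_def)

lemma funs_between_comp:
  "funs_between A B f \<Longrightarrow> funs_between B C g \<Longrightarrow> funs_between A C (\<lambda>i. g i \<circ> f i)"
  by (fastforce simp: funs_between_def)

lemma funs_between_Emb: "funs_between A (one_plus A) (\<lambda>i. Emb)"
  by (auto simp: funs_between_def one_plus_def)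

lemma funs_between_map_one_plus:
  "funs_between A B f \<Longrightarrow> funs_between (one_plus A) (one_plus B) (\<lambda>i. map_one_plus (f i))"
  by (fastforce simp: funs_between_def one_plus_def)

lemma funs_between_from_one_plus:
  "(\<And>i. c i \<in> A i) \<Longrightarrow> funs_between (one_plus A) A (\<lambda>i. from_one_plus (c i))"
  by (auto simp: funs_between_def one_plus_def)

lemma funs_between_fst_univ: "funs_between (prod_types A B) A (\<lambda>i. fst_univ)"
  by (auto simp: funs_between_def prod_types_def)

lemma funs_between_snd_univ: "funs_between (prod_types A B) B (\<lambda>i. snd_univ)"
  by (auto simp: funs_between_def prod_types_def)

lemma rels_between_rel_one_plus:
  "rels_between A B R \<Longrightarrow> rels_between (one_plus A) (one_plus B) (\<lambda>i. rel_one_plus (R i))"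
  by (fastforce simp: rels_between_def rel_one_plus_def one_plus_def)

lemma rel_one_plus_relcomp: "rel_one_plus R O rel_one_plus S = rel_one_plus (R O S)"
  by (auto simp: rel_one_plus_def)

section \<open>Relator rules for an arbitrary BNF\<close>

context nary_bnf
begin

text \<open>The pairing \<open>h\<close> of \<open>f\<close> and \<open>g\<close> turns
  \<open>z\<close> into a witness for \<open>in_rel\<close>; by \<open>map_comp\<close> its two
  projections are the two given images.\<close>

lemma rel_mapI:
  assumes T: "is_types A" "is_types B" "is_types C"
    and fg: "funs_between C A f" "funs_between C B g" and R: "rels_between A B R"
    and z: "z \<in> F C" and rel: "\<And>i c. c \<in> setF C i z \<Longrightarrow> (f i c, g i c) \<in> R i"
  shows "(mapF C A f z, mapF C B g z) \<in> relF A B R"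
proof -
  let ?P = "prod_types A B"
  define h where "h = (\<lambda>i c. Pr (f i c) (g i c))"
  have P: "is_types ?P" using T by (simp add: is_types_prod_types)
  have h: "funs_between C ?P h" using fg by (fastforce simp: funs_between_def prod_types_def h_def)
  have hz: "mapF C ?P h z \<in> F ?P" using map_type[OF T(3) P h z] .
  have "setF ?P i (mapF C ?P h z) \<subseteq> {Pr a b | a b. (a, b) \<in> R i}" for i
    using rel unfolding set_map[OF T(3) P h z] by (auto simp: h_def)
  moreover have "mapF ?P A (\<lambda>i. fst_univ) (mapF C ?P h z) = mapF C A f z"
    by (subst map_comp[OF T(3) P T(1) h funs_between_fst_univ z]) (simp add: h_def comp_def)
  moreover have "mapF ?P B (\<lambda>i. snd_univ) (mapF C ?P h z) = mapF C B g z"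
    by (subst map_comp[OF T(3) P T(2) h funs_between_snd_univ z]) (simp add: h_def comp_def)
  ultimately show ?thesis
    using hz by (subst in_rel[OF T(1,2) R map_type[OF T(3,1) fg(1) z] map_type[OF T(3,2) fg(2) z]])
      blast
qed

text \<open>\<open>rel_mapI\<close> with two identity functions. It restates a bound on the atoms of
  \<open>x\<close> as a relator fact, the form that (WP) accepts.\<close>

lemma rel_Id_onI:
  assumes "is_types A" "x \<in> F A" "\<And>i. D i \<subseteq> A i" "\<And>i. setF A i x \<subseteq> D i"
  shows "(x, x) \<in> relF A A (\<lambda>i. Id_on (D i))"
proof -
  have "rels_between A A (\<lambda>i. Id_on (D i))"
    using assms(3) by (fastforce simp: rels_between_def)
  then show ?thesis
    using rel_mapI[of A A A "\<lambda>i. id" "\<lambda>i. id" "\<lambda>i. Id_on (D i)" x] assms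
    by (auto simp: funs_between_id map_id)
qed

lemma rel_witness:
  assumes "is_types A" "is_types B" "rels_between A B R" "(x, y) \<in> relF A B R"
  obtains z where "z \<in> F (prod_types A B)"
    "\<And>i. setF (prod_types A B) i z \<subseteq> {Pr a b | a b. (a, b) \<in> R i}"
    "mapF (prod_types A B) A (\<lambda>i. fst_univ) z = x"
    "mapF (prod_types A B) B (\<lambda>i. snd_univ) z = y"
proof -
  have "x \<in> F A" "y \<in> F B" using rel_type[OF assms(1-3)] assms(4) by auto
  then show ?thesis using that assms(4) in_rel[OF assms(1-3)] by blast
qed

text \<open>The atoms of \<open>x\<close> are first components of the atoms of a witness. This reads
  bounds on atoms back from the relator facts that (WP) delivers.\<close>

lemma set_subset_Domain:
  assumes "is_types A" "is_types B" "rels_between A B R" "(x, y) \<in> relF A B R"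
  shows "setF A i x \<subseteq> Domain (R i)"
proof -
  obtain z where z: "z \<in> F (prod_types A B)"
    "\<And>i. setF (prod_types A B) i z \<subseteq> {Pr a b | a b. (a, b) \<in> R i}"
    "mapF (prod_types A B) A (\<lambda>i. fst_univ) z = x"
    "mapF (prod_types A B) B (\<lambda>i. snd_univ) z = y"
    by (rule rel_witness[OF assms]) (rule that; blast)
  show ?thesis
    using z(2)[of i] unfolding z(3)[symmetric]
    by (subst set_map[OF is_types_prod_types[OF assms(1,2)] assms(1) funs_between_fst_univ z(1)])
      fastforce
qed

text \<open>On the atoms of a witness both projections agree, so \<open>map_cong\<close> identifies
  the two images.\<close>

lemma rel_subset_Id:
  assumes "is_types A" "rels_between A A R" "(x, y) \<in> relF A A R" "\<And>i. R i \<subseteq> Id"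
  shows "x = y"
proof -
  obtain z where z: "z \<in> F (prod_types A A)"
    "\<And>i. setF (prod_types A A) i z \<subseteq> {Pr a b | a b. (a, b) \<in> R i}"
    "mapF (prod_types A A) A (\<lambda>i. fst_univ) z = x" "mapF (prod_types A A) A (\<lambda>i. snd_univ) z = y"
    by (rule rel_witness[OF assms(1) assms(1-3)]) (rule that; blast)
  have "\<forall>i. \<forall>p\<in>setF (prod_types A A) i z. fst_univ p = snd_univ p"
    using z(2) assms(4) by fastforce
  then show ?thesis
    using map_cong[OF is_types_prod_types[OF assms(1,1)] assms(1) funs_between_fst_univ
        funs_between_snd_univ z(1)] z(3,4) by simp
qed

end

section \<open>The equivalence and its compatibility with the mapper\<close>

locale nary_bnf_quotient = nary_bnf F mapF setF bdF relF
  for F :: "('n::finite, 'a) types \<Rightarrow> 'x set"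
    and mapF :: "('n, 'a) types \<Rightarrow> ('n, 'a) types \<Rightarrow> ('n \<Rightarrow> 'a univ \<Rightarrow> 'a univ) \<Rightarrow> 'x \<Rightarrow> 'x"
    and setF :: "('n, 'a) types \<Rightarrow> 'n \<Rightarrow> 'x \<Rightarrow> 'a univ set"
    and bdF :: "'k rel"
    and relF :: "('n, 'a) types \<Rightarrow> ('n, 'a) types \<Rightarrow> ('n \<Rightarrow> 'a univ rel) \<Rightarrow> 'x rel" +
  fixes sim :: "('n, 'a) types \<Rightarrow> 'x rel"
  assumes equiv_sim: "is_types T \<Longrightarrow> equiv (F T) (sim T)"
    and WI: "\<lbrakk>is_types T; \<And>i. \<A> i \<subseteq> Pow (T i); \<And>i. \<A> i \<noteq> {}; \<And>i. \<Inter>(\<A> i) \<noteq> {}\<rbrakk> \<Longrightarrow>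
      \<Inter>{F_in F setF T A // sim T | A. \<forall>i. A i \<in> \<A> i}
        \<subseteq> \<Inter>{F_in F setF T A | A. \<forall>i. A i \<in> \<A> i} // sim T"
    and WP: "\<lbrakk>is_types A; is_types B; is_types C; rels_between A B R; rels_between B C S;
        \<And>i. R i O S i \<noteq> {}\<rbrakk> \<Longrightarrow>
      relF A B R O sim B O relF B C S \<subseteq> sim A O relF A C (\<lambda>i. R i O S i) O sim C"
begin

lemma sim_refl: "is_types A \<Longrightarrow> x \<in> F A \<Longrightarrow> (x, x) \<in> sim A"
  using equiv_sim[of A] by (auto simp: equiv_def refl_on_def)

lemma sim_sym: "is_types A \<Longrightarrow> (x, y) \<in> sim A \<Longrightarrow> (y, x) \<in> sim A"
  using equiv_sim[of A] by (auto simp: equiv_def dest: symD)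

lemma sim_trans: "is_types A \<Longrightarrow> (x, y) \<in> sim A \<Longrightarrow> (y, z) \<in> sim A \<Longrightarrow> (x, z) \<in> sim A"
  using equiv_sim[of A] by (auto simp: equiv_def dest: transD)

lemma sim_carrier: "is_types A \<Longrightarrow> (x, y) \<in> sim A \<Longrightarrow> x \<in> F A \<and> y \<in> F A"
  using equiv_sim[of A] equiv_class_eq_iff by metis

lemma class_eq_iff:
  "is_types A \<Longrightarrow> x \<in> F A \<Longrightarrow> y \<in> F A \<Longrightarrow> sim A `` {x} = sim A `` {y} \<longleftrightarrow> (x, y) \<in> sim A"
  using equiv_sim[of A] eq_equiv_class_iff by metis

lemma WP_E:
  assumes "is_types A" "is_types B" "is_types C" "rels_between A B R" "rels_between B C S"
    "\<And>i. R i O S i \<noteq> {}" "(x, y) \<in> relF A B R" "(y, y') \<in> sim B" "(y', z) \<in> relF B C S"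
  obtains u v where "(x, u) \<in> sim A" "(u, v) \<in> relF A C (\<lambda>i. R i O S i)" "(v, z) \<in> sim C"
  using WP[OF assms(1-6)] assms(7-9) by blast

text \<open>Apply (WP) to the converse graph \<open>R\<close> of \<open>f\<close> and its graph
  \<open>S\<close>, along the path from \<open>mapF A B f x\<close> to \<open>x\<close>, by
  \<open>sim\<close> to \<open>y\<close>, and on to \<open>mapF A B f y\<close>. Since
  \<open>R i O S i\<close> lies in the identity, the middle step that (WP) returns is an
  equality.\<close>

lemma map_sim:
  assumes T: "is_types A" "is_types B" and f: "funs_between A B f" and xy: "(x, y) \<in> sim A"
  shows "(mapF A B f x, mapF A B f y) \<in> sim B"
proof -
  define R where "R = (\<lambda>i. {(f i a, a) | a. a \<in> A i})"
  define S where "S = (\<lambda>i. {(a, f i a) | a. a \<in> A i})"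
  have x: "x \<in> F A" and y: "y \<in> F A" using sim_carrier[OF T(1) xy] by auto
  have R: "rels_between B A R" and S: "rels_between A B S"
    using f by (auto simp: rels_between_def funs_between_def R_def S_def)
  have ne: "R i O S i \<noteq> {}" for i
    using T(1) by (fastforce simp: is_types_def R_def S_def relcomp_unfold)
  \<comment> \<open>\<open>rel_mapI\<close> relates two images of one element, so \<open>x\<close>
    is written as its own image under the identity.\<close>
  have "(mapF A B f x, mapF A A (\<lambda>i. id) x) \<in> relF B A R"
    using set_type[OF T(1) x]
    by (intro rel_mapI T R f funs_between_id x) (auto simp: R_def)
  then have 1: "(mapF A B f x, x) \<in> relF B A R" by (simp add: map_id T x)
  have "(mapF A A (\<lambda>i. id) y, mapF A B f y) \<in> relF A B S"
    using set_type[OF T(1) y]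
    by (intro rel_mapI T S f funs_between_id y) (auto simp: S_def)
  then have 2: "(y, mapF A B f y) \<in> relF A B S" by (simp add: map_id T y)
  obtain u v where uv: "(mapF A B f x, u) \<in> sim B" "(u, v) \<in> relF B B (\<lambda>i. R i O S i)"
    "(v, mapF A B f y) \<in> sim B"
    using WP_E[OF T(2,1,2) R S ne 1 xy 2] .
  have "u = v"
    by (rule rel_subset_Id[OF T(2) _ uv(2)])
      (use f in \<open>auto simp: rels_between_def funs_between_def R_def S_def\<close>)
  then show ?thesis using uv sim_trans[OF T(2)] by blast
qed

section \<open>Passing to extended types and back\<close>

lemma map_Emb_type: "is_types A \<Longrightarrow> x \<in> F A \<Longrightarrow> mapF A (one_plus A) (\<lambda>i. Emb) x \<in> F (one_plus A)"
  by (simp add: map_type funs_between_Emb)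

lemma map_Emb_sim:
  "is_types A \<Longrightarrow> (x, y) \<in> sim A \<Longrightarrow>
    (mapF A (one_plus A) (\<lambda>i. Emb) x, mapF A (one_plus A) (\<lambda>i. Emb) y) \<in> sim (one_plus A)"
  by (simp add: map_sim funs_between_Emb)

text \<open>Naturality of \<open>Emb\<close>: both sides are the image of \<open>x\<close> under
  \<open>Emb\<close> after \<open>f i\<close>.\<close>

lemma map_one_plus_map_Emb:
  assumes "is_types A" "is_types B" "funs_between A B f" "x \<in> F A"
  shows "mapF (one_plus A) (one_plus B) (\<lambda>i. map_one_plus (f i)) (mapF A (one_plus A) (\<lambda>i. Emb) x)
    = mapF B (one_plus B) (\<lambda>i. Emb) (mapF A B f x)"
  using assms
  by (simp add: map_comp[where B = "one_plus A"] map_comp[where B = B] funs_between_Emb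
      funs_between_map_one_plus comp_def)

lemma from_one_plus_map_Emb:
  assumes "is_types A" "x \<in> F A" "\<And>i. c i \<in> A i"
  shows "mapF (one_plus A) A (\<lambda>i. from_one_plus (c i)) (mapF A (one_plus A) (\<lambda>i. Emb) x) = x"
  using assms
  by (simp add: map_comp[where B = "one_plus A"] funs_between_Emb
      funs_between_from_one_plus map_id[unfolded id_def] comp_def)

text \<open>\<open>Emb\<close> has the left inverse \<open>from_one_plus (c i)\<close> for any
  default \<open>c i\<close> in the nonempty \<open>A i\<close>, and \<open>map_sim\<close> applies
  to both functions. Equivalences proved over \<open>one_plus A\<close> can thus be pulled back to
  \<open>A\<close>.\<close>

lemma map_Emb_sim_iff:
  assumes A: "is_types A" and xy: "x \<in> F A" "y \<in> F A"
  shows "(mapF A (one_plus A) (\<lambda>i. Emb) x, mapF A (one_plus A) (\<lambda>i. Emb) y) \<in> sim (one_plus A)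
    \<longleftrightarrow> (x, y) \<in> sim A"
proof
  assume *: "(mapF A (one_plus A) (\<lambda>i. Emb) x, mapF A (one_plus A) (\<lambda>i. Emb) y) \<in> sim (one_plus A)"
  define c where "c = (\<lambda>i. SOME a. a \<in> A i)"
  have c: "c i \<in> A i" for i using A by (simp add: c_def some_in_eq is_types_def)
  show "(x, y) \<in> sim A"
    using map_sim[OF is_types_one_plus A funs_between_from_one_plus[OF c] *]
    by (simp add: from_one_plus_map_Emb[OF A _ c] xy)
qed (simp add: map_Emb_sim A)

section \<open>Equivalent elements with fewer atoms\<close>

lemma sim_F_in_Int:
  assumes T: "is_types T" and yz: "(y, z) \<in> sim T"
    and "\<And>i. C i \<subseteq> T i" "\<And>i. D i \<subseteq> T i" "\<And>i. C i \<inter> D i \<noteq> {}"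
    and "\<And>i. setF T i y \<subseteq> C i" "\<And>i. setF T i z \<subseteq> D i"
  obtains u where "(y, u) \<in> sim T" "\<And>i. setF T i u \<subseteq> C i \<inter> D i"
proof -
  have 1: "rels_between T T (\<lambda>i. Id_on (C i))" "rels_between T T (\<lambda>i. Id_on (D i))"
    using assms(3,4) by (fastforce simp: rels_between_def)+
  have 2: "(y, y) \<in> relF T T (\<lambda>i. Id_on (C i))" "(z, z) \<in> relF T T (\<lambda>i. Id_on (D i))"
    using sim_carrier[OF T yz] by (simp_all add: rel_Id_onI T assms(3,4,6,7))
  \<comment> \<open>This composition is the identity on \<open>C i \<inter> D i\<close>. From
    \<open>y\<close> related to itself and \<open>z\<close> related to itself, (WP) produces an
    element equivalent to \<open>y\<close> whose atoms lie in the intersection.\<close>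
  have 3: "Id_on (C i) O Id_on (D i) \<noteq> {}" for i
    using assms(5)[of i] by blast
  obtain u v where uv: "(y, u) \<in> sim T" "(u, v) \<in> relF T T (\<lambda>i. Id_on (C i) O Id_on (D i))"
    "(v, z) \<in> sim T"
    using WP_E[OF T T T 1 3 2(1) yz 2(2)] .
  have "rels_between T T (\<lambda>i. Id_on (C i) O Id_on (D i))"
    using assms(3,4) by (fastforce simp: rels_between_def)
  from set_subset_Domain[OF T T this uv(2)] have "setF T i u \<subseteq> C i \<inter> D i" for i
    by blast
  with uv(1) that show ?thesis by blast
qed

text \<open>A different representative \<open>w i\<close> may bound the atoms at each index. As
  there are finitely many indices, one \<open>y\<close> meeting all bounds is built by treating them
  one at a time; the point \<open>s i\<close> keeps the intersections nonempty.\<close>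

lemma sim_F_in_choice:
  assumes T: "is_types T" and x: "x \<in> F T" and s: "\<And>i. s i \<in> T i"
    and w: "\<And>i. (x, w i) \<in> sim T"
  obtains y where "(x, y) \<in> sim T" "\<And>i. setF T i y \<subseteq> insert (s i) (setF T i (w i))"
proof -
  have "\<exists>y. (x, y) \<in> sim T \<and> (\<forall>i\<in>I. setF T i y \<subseteq> insert (s i) (setF T i (w i)))"
    if "finite I" for I
    using that
  proof induction
    case empty
    then show ?case using sim_refl[OF T x] by blast
  next
    case (insert j I)
    then obtain y where y: "(x, y) \<in> sim T"
      "\<forall>i\<in>I. setF T i y \<subseteq> insert (s i) (setF T i (w i))" by blast
    have yw: "(y, w j) \<in> sim T" using y(1) w sim_sym[OF T] sim_trans[OF T] by blast
    note F = sim_carrier[OF T yw]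
    \<comment> \<open>Intersecting with the atoms of \<open>w j\<close> gives the new bound at
      \<open>j\<close>; intersecting with those of \<open>y\<close> preserves the bounds already
      achieved on \<open>I\<close>.\<close>
    obtain u where "(y, u) \<in> sim T"
      "\<And>i. setF T i u \<subseteq> insert (s i) (setF T i y) \<inter> insert (s i) (setF T i (w j))"
      by (rule sim_F_in_Int[OF T yw, of "\<lambda>i. insert (s i) (setF T i y)"
            "\<lambda>i. insert (s i) (setF T i (w j))"])
        (use F s set_type[OF T] in auto)
    with y show ?case using sim_trans[OF T y(1)] by (intro exI[of _ u]) blast
  qed
  from this[of UNIV] show ?thesis using that by auto
qed

section \<open>Setters of the quotient, computed on representatives\<close>

definition set_class :: "('n, 'a) types \<Rightarrow> 'n \<Rightarrow> 'x \<Rightarrow> 'a univ set" where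
  "set_class A i x = (\<Inter>y \<in> sim (one_plus A) `` {mapF A (one_plus A) (\<lambda>i. Emb) x}.
    {a. Emb a \<in> setF (one_plus A) i y})"

text \<open>The image of \<open>x\<close> under \<open>Emb\<close> is itself a member of the class
  over which \<open>set_class\<close> intersects.\<close>

lemma set_class_subset:
  assumes "is_types A" "x \<in> F A"
  shows "set_class A i x \<subseteq> setF A i x"
proof
  fix a assume "a \<in> set_class A i x"
  then have "Emb a \<in> setF (one_plus A) i (mapF A (one_plus A) (\<lambda>i. Emb) x)"
    using sim_refl[OF is_types_one_plus map_Emb_type[OF assms]] by (auto simp: set_class_def)
  then show "a \<in> setF A i x"
    by (auto simp: set_map assms funs_between_Emb)
qed

lemma set_class_sim:
  assumes "is_types A" "(x, y) \<in> sim A"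
  shows "set_class A i x = set_class A i y"
  using equiv_class_eq[OF equiv_sim[OF is_types_one_plus] map_Emb_sim[OF assms]]
  by (simp add: set_class_def)

text \<open>(WI) is applied to the atom sets of all representatives of the embedded
  \<open>x\<close>. Its left-hand side contains the class because \<open>sim_F_in_choice\<close>
  realizes any mixed choice of atom sets by a single representative; its right-hand side yields a
  representative below all of them.\<close>

lemma minimal_representative:
  assumes A: "is_types A" and x: "x \<in> F A"
  obtains y where "(mapF A (one_plus A) (\<lambda>i. Emb) x, y) \<in> sim (one_plus A)"
    "\<And>i. setF (one_plus A) i y \<subseteq> insert Star (Emb ` set_class A i x)"
proof -
  let ?T = "one_plus A"
  let ?x = "mapF A ?T (\<lambda>i. Emb) x"
  \<comment> \<open>Inserting \<open>Star\<close> into every member makes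
    \<open>\<Inter>(\<A> i)\<close> nonempty, as (WI) requires.\<close>
  define \<A> where "\<A> = (\<lambda>i. {insert Star (setF ?T i y) | y. (?x, y) \<in> sim ?T})"
  have x': "?x \<in> F ?T" by (rule map_Emb_type[OF A x])
  have Star: "Star \<in> ?T i" for i by (simp add: one_plus_def)
  have sub: "setF ?T i y \<subseteq> ?T i" if "(?x, y) \<in> sim ?T" for i y
    using that sim_carrier[OF is_types_one_plus] set_type[OF is_types_one_plus] by blast
  have "\<A> i \<subseteq> Pow (?T i)" for i using sub Star unfolding \<A>_def by blast
  moreover have "\<A> i \<noteq> {}" for i using sim_refl[OF is_types_one_plus x'] by (auto simp: \<A>_def)
  moreover have "\<Inter>(\<A> i) \<noteq> {}" for i by (auto simp: \<A>_def)
  ultimately have *: "\<Inter>{F_in F setF ?T C // sim ?T | C. \<forall>i. C i \<in> \<A> i}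
      \<subseteq> \<Inter>{F_in F setF ?T C | C. \<forall>i. C i \<in> \<A> i} // sim ?T"
    by (intro WI) auto
  have "sim ?T `` {?x} \<in> F_in F setF ?T C // sim ?T" if "\<forall>i. C i \<in> \<A> i" for C
  proof -
    from that have "\<forall>i. \<exists>w. C i = insert Star (setF ?T i w) \<and> (?x, w) \<in> sim ?T"
      by (auto simp: \<A>_def)
    then obtain w where w: "\<And>i. C i = insert Star (setF ?T i (w i))" "\<And>i. (?x, w i) \<in> sim ?T"
      by metis
    obtain y where y: "(?x, y) \<in> sim ?T" "\<And>i. setF ?T i y \<subseteq> insert Star (setF ?T i (w i))"
      by (rule sim_F_in_choice[where s = "\<lambda>i. Star" and w = w, OF is_types_one_plus x' Star w(2)]) (rule that; blast)
    have "y \<in> F_in F setF ?T C"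
      using y sim_carrier[OF is_types_one_plus y(1)] by (simp add: F_in_def w(1))
    moreover have "sim ?T `` {?x} = sim ?T `` {y}"
      by (rule equiv_class_eq[OF equiv_sim[OF is_types_one_plus] y(1)])
    ultimately show ?thesis by (auto simp: quotient_def)
  qed
  with * have "sim ?T `` {?x} \<in> \<Inter>{F_in F setF ?T C | C. \<forall>i. C i \<in> \<A> i} // sim ?T"
    by blast
  then obtain y where y: "\<And>C. \<forall>i. C i \<in> \<A> i \<Longrightarrow> y \<in> F_in F setF ?T C"
    and cls: "sim ?T `` {?x} = sim ?T `` {y}"
    by (auto simp: quotient_def)
  \<comment> \<open>Membership in the carrier comes from \<open>F_in\<close>, so one admissible
    choice is exhibited: the one given by \<open>?x\<close> itself.\<close>
  have "y \<in> F ?T"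
    using y[of "\<lambda>i. insert Star (setF ?T i ?x)"] sim_refl[OF is_types_one_plus x']
    by (auto simp: F_in_def \<A>_def)
  with cls x' have xy: "(?x, y) \<in> sim ?T" using class_eq_iff[OF is_types_one_plus] by blast
  moreover have "setF ?T i y \<subseteq> insert Star (Emb ` set_class A i x)" for i
  proof
    fix t assume t: "t \<in> setF ?T i y"
    \<comment> \<open>Taking all components of \<open>C\<close> from one representative
      \<open>w\<close> bounds the atoms of \<open>y\<close> by those of \<open>w\<close>. Over all
      \<open>w\<close>, only \<open>Star\<close> and embedded elements of
      \<open>set_class A i x\<close> survive.\<close>
    have "t \<in> insert Star (setF ?T i w)" if "(?x, w) \<in> sim ?T" for w
      using y[of "\<lambda>i. insert Star (setF ?T i w)"] that t by (auto simp: F_in_def \<A>_def)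
    moreover have "t = Star \<or> (\<exists>a. t = Emb a)" using t sub[OF xy] by (auto simp: one_plus_def)
    ultimately show "t \<in> insert Star (Emb ` set_class A i x)"
      by (auto simp: set_class_def)
  qed
  ultimately show ?thesis using that by blast
qed

text \<open>For the inclusion from left to right, a minimal representative for \<open>x\<close> is
  mapped forward. For the converse, any representative \<open>w\<close> for the image is pulled back
  by (WP) to a representative for \<open>x\<close>, in which every element of
  \<open>set_class A i x\<close> must occur.\<close>

lemma set_class_map:
  assumes A: "is_types A" and B: "is_types B" and f: "funs_between A B f" and x: "x \<in> F A"
  shows "set_class B i (mapF A B f x) = f i ` set_class A i x"
proof
  let ?A = "one_plus A" and ?B = "one_plus B"
  let ?x = "mapF A ?A (\<lambda>i. Emb) x" and ?fx = "mapF B ?B (\<lambda>i. Emb) (mapF A B f x)"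
  let ?f = "\<lambda>i. map_one_plus (f i)"
  note f' = funs_between_map_one_plus[OF f]
  note T = is_types_one_plus[of A] is_types_one_plus[of B]
  note eq = map_one_plus_map_Emb[OF A B f x]
  note x' = map_Emb_type[OF A x]
  obtain y where y: "(?x, y) \<in> sim ?A" "\<And>i. setF ?A i y \<subseteq> insert Star (Emb ` set_class A i x)"
    by (rule minimal_representative[OF A x]) (rule that; blast)
  have "(?fx, mapF ?A ?B ?f y) \<in> sim ?B" using map_sim[OF T f' y(1)] by (simp add: eq)
  then have "Emb b \<in> ?f i ` setF ?A i y" if "b \<in> set_class B i (mapF A B f x)" for b
    using that sim_carrier[OF T(1) y(1)] unfolding set_class_def
    by (subst set_map[OF T f', symmetric]) auto
  then show "set_class B i (mapF A B f x) \<subseteq> f i ` set_class A i x"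
    using y(2)[of i] by fastforce
  show "f i ` set_class A i x \<subseteq> set_class B i (mapF A B f x)"
  proof (clarsimp simp: set_class_def[of B])
    fix a w assume a: "a \<in> set_class A i x" and w: "(?fx, w) \<in> sim ?B"
    \<comment> \<open>\<open>R\<close> is the graph of \<open>?f\<close> and leads from
      \<open>?x\<close> to \<open>?fx\<close>; \<open>S\<close> fixes the atoms of \<open>w\<close>
      and \<open>Star\<close>. After (WP), every atom of \<open>u\<close> is sent by
      \<open>?f\<close> to an atom of \<open>w\<close> or to \<open>Star\<close>, and the latter is
      impossible for the image of \<open>Emb a\<close>.\<close>
    define R where "R = (\<lambda>i. {(t, ?f i t) | t. t \<in> ?A i})"
    define S where "S = (\<lambda>i. Id_on (insert Star (setF ?B i w)))"
    have wF: "w \<in> F ?B" using sim_carrier[OF T(2) w] by simp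
    have D: "insert Star (setF ?B i w) \<subseteq> ?B i" for i
      using set_type[OF T(2) wF] by (auto simp: one_plus_def)
    have R: "rels_between ?A ?B R" using f' by (auto simp: rels_between_def funs_between_def R_def)
    have S: "rels_between ?B ?B S" using D by (fastforce simp: rels_between_def S_def)
    have RS: "rels_between ?A ?B (\<lambda>i. R i O S i)"
      using R S unfolding rels_between_def by fast
    \<comment> \<open>\<open>map_one_plus\<close> fixes \<open>Star\<close>, which provides the
      nonemptiness condition of (WP).\<close>
    have "(Star, Star) \<in> R i O S i" for i by (force simp: R_def S_def one_plus_def)
    then have ne: "R i O S i \<noteq> {}" for i by blast
    have "(mapF ?A ?A (\<lambda>i. id) ?x, mapF ?A ?B ?f ?x) \<in> relF ?A ?B R"
      using set_type[OF T(1) x']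
      by (intro rel_mapI T R f' funs_between_id x') (auto simp: R_def)
    then have 1: "(?x, ?fx) \<in> relF ?A ?B R" using map_id[OF T(1) x'] eq by simp
    have 2: "(w, w) \<in> relF ?B ?B S"
      unfolding S_def by (intro rel_Id_onI T(2) wF D) auto
    obtain u v where u: "(?x, u) \<in> sim ?A" "(u, v) \<in> relF ?A ?B (\<lambda>i. R i O S i)"
      "(v, w) \<in> sim ?B"
      using WP_E[OF T T(2) R S ne 1 w 2] .
    have "Emb a \<in> setF ?A i u" using a u(1) by (auto simp: set_class_def)
    then have "Emb a \<in> Domain (R i O S i)" using set_subset_Domain[OF T RS u(2)] by blast
    then show "Emb (f i a) \<in> setF ?B i w" by (auto simp: R_def S_def)
  qed
qed

text \<open>The extended functions agree on all atoms of a minimal representative, hence have the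
  same image there. This gives equivalence over \<open>one_plus B\<close>, and
  \<open>map_Emb_sim_iff\<close> returns to \<open>B\<close>.\<close>

lemma map_sim_cong:
  assumes A: "is_types A" and B: "is_types B" and f: "funs_between A B f" and g: "funs_between A B g"
    and x: "x \<in> F A" and fg: "\<And>i a. a \<in> set_class A i x \<Longrightarrow> f i a = g i a"
  shows "(mapF A B f x, mapF A B g x) \<in> sim B"
proof -
  let ?A = "one_plus A" and ?B = "one_plus B"
  note T = is_types_one_plus[of A] is_types_one_plus[of B]
  obtain y where y: "(mapF A ?A (\<lambda>i. Emb) x, y) \<in> sim ?A"
    "\<And>i. setF ?A i y \<subseteq> insert Star (Emb ` set_class A i x)"
    by (rule minimal_representative[OF A x]) (rule that; blast)
  have "mapF ?A ?B (\<lambda>i. map_one_plus (f i)) y = mapF ?A ?B (\<lambda>i. map_one_plus (g i)) y"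
    by (intro map_cong T funs_between_map_one_plus f g)
      (use sim_carrier[OF T(1) y(1)] y(2) fg in fastforce)+
  then have "(mapF B ?B (\<lambda>i. Emb) (mapF A B f x), mapF B ?B (\<lambda>i. Emb) (mapF A B g x)) \<in> sim ?B"
    using map_sim[OF T funs_between_map_one_plus[OF f] y(1)]
      map_sim[OF T funs_between_map_one_plus[OF g] y(1)] sim_sym[OF T(2)] sim_trans[OF T(2)]
    unfolding map_one_plus_map_Emb[OF A B f x] map_one_plus_map_Emb[OF A B g x] by metis
  then show ?thesis using map_Emb_sim_iff[OF B] map_type[OF A B] f g x by blast
qed

section \<open>Relator of the quotient, computed on representatives\<close>

definition rel_class :: "('n, 'a) types \<Rightarrow> ('n, 'a) types \<Rightarrow> ('n \<Rightarrow> 'a univ rel) \<Rightarrow> 'x \<Rightarrow> 'x \<Rightarrow> bool" where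
  "rel_class A B R x y \<longleftrightarrow>
    (mapF A (one_plus A) (\<lambda>i. Emb) x, mapF B (one_plus B) (\<lambda>i. Emb) y)
      \<in> sim (one_plus A) O relF (one_plus A) (one_plus B) (\<lambda>i. rel_one_plus (R i)) O sim (one_plus B)"

lemma rel_class_sim:
  assumes "is_types A" "is_types B" "(x, x') \<in> sim A" "(y, y') \<in> sim B" "rel_class A B R x y"
  shows "rel_class A B R x' y'"
  using assms(5) map_Emb_sim[OF assms(1) sim_sym[OF assms(1,3)]] map_Emb_sim[OF assms(2,4)]
    sim_trans[OF is_types_one_plus]
  unfolding rel_class_def by blast

text \<open>(WP) applies even when some \<open>R i O S i\<close> is empty, because the extended
  relations always compose at \<open>Star\<close>; \<open>rel_one_plus_relcomp\<close> then moves
  the composition inside.\<close>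

lemma rel_class_trans:
  assumes T: "is_types A" "is_types B" "is_types C" and R: "rels_between A B R"
    and S: "rels_between B C S" and xy: "rel_class A B R x y" and yz: "rel_class B C S y z"
  shows "rel_class A C (\<lambda>i. R i O S i) x z"
proof -
  let ?A = "one_plus A" and ?B = "one_plus B" and ?C = "one_plus C"
  let ?R = "\<lambda>i. rel_one_plus (R i)" and ?S = "\<lambda>i. rel_one_plus (S i)"
  obtain u v where uv: "(mapF A ?A (\<lambda>i. Emb) x, u) \<in> sim ?A" "(u, v) \<in> relF ?A ?B ?R"
    "(v, mapF B ?B (\<lambda>i. Emb) y) \<in> sim ?B"
    using xy by (auto simp: rel_class_def)
  obtain v' w where vw: "(mapF B ?B (\<lambda>i. Emb) y, v') \<in> sim ?B" "(v', w) \<in> relF ?B ?C ?S"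
    "(w, mapF C ?C (\<lambda>i. Emb) z) \<in> sim ?C"
    using yz by (auto simp: rel_class_def)
  have ne: "?R i O ?S i \<noteq> {}" for i by (auto simp: rel_one_plus_relcomp rel_one_plus_def)
  have vv': "(v, v') \<in> sim ?B" using uv(3) vw(1) sim_trans[OF is_types_one_plus] by blast
  obtain u' w' where "(u, u') \<in> sim ?A" "(u', w') \<in> relF ?A ?C (\<lambda>i. ?R i O ?S i)" "(w', w) \<in> sim ?C"
    using WP_E[OF is_types_one_plus is_types_one_plus is_types_one_plus
        rels_between_rel_one_plus[OF R] rels_between_rel_one_plus[OF S] ne uv(2) vv' vw(2)] .
  then show ?thesis
    using uv(1) vw(3) sim_trans[OF is_types_one_plus]
    unfolding rel_class_def rel_one_plus_relcomp by blast
qed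

text \<open>A minimal representative for \<open>z\<close> over the extended product has only atoms
  \<open>Star\<close> and \<open>Emb p\<close> with \<open>p\<close> encoding a pair in
  \<open>R i\<close>. Its extended projections are therefore related, and by naturality they are
  equivalent to the embedded projections of \<open>z\<close>.\<close>

lemma rel_class_if_witness:
  assumes T: "is_types A" "is_types B" and R: "rels_between A B R"
    and z: "z \<in> F (prod_types A B)"
    and set_z: "\<And>i. set_class (prod_types A B) i z \<subseteq> {Pr a b | a b. (a, b) \<in> R i}"
  shows "rel_class A B R (mapF (prod_types A B) A (\<lambda>i. fst_univ) z)
    (mapF (prod_types A B) B (\<lambda>i. snd_univ) z)"
proof -
  let ?A = "one_plus A" and ?B = "one_plus B" and ?P = "one_plus (prod_types A B)"
  let ?f = "\<lambda>i. map_one_plus fst_univ" and ?g = "\<lambda>i. map_one_plus snd_univ"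
  note P = is_types_prod_types[OF T]
  note T' = is_types_one_plus
  note fst' = funs_between_map_one_plus[OF funs_between_fst_univ[of A B]]
  note snd' = funs_between_map_one_plus[OF funs_between_snd_univ[of A B]]
  obtain w where w: "(mapF (prod_types A B) ?P (\<lambda>i. Emb) z, w) \<in> sim ?P"
    "\<And>i. setF ?P i w \<subseteq> insert Star (Emb ` set_class (prod_types A B) i z)"
    by (rule minimal_representative[OF P z]) (rule that; blast)
  have wF: "w \<in> F ?P" using sim_carrier[OF T' w(1)] by simp
  have "(?f i t, ?g i t) \<in> rel_one_plus (R i)" if t: "t \<in> setF ?P i w" for i t
  proof -
    consider "t = Star" | p where "t = Emb p" "p \<in> set_class (prod_types A B) i z"
      using subsetD[OF w(2) t] by blast
    then show ?thesis using set_z[of i] by cases (auto simp: rel_one_plus_def)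
  qed
  then have "(mapF ?P ?A ?f w, mapF ?P ?B ?g w) \<in> relF ?A ?B (\<lambda>i. rel_one_plus (R i))"
    by (intro rel_mapI T' fst' snd' rels_between_rel_one_plus R wF) auto
  moreover note map_sim[OF T' T' fst' w(1), unfolded map_one_plus_map_Emb[OF P T(1) funs_between_fst_univ z]]
  moreover note sim_sym[OF T' map_sim[OF T' T' snd' w(1),
        unfolded map_one_plus_map_Emb[OF P T(2) funs_between_snd_univ z]]]
  ultimately show ?thesis unfolding rel_class_def by blast
qed

text \<open>The relator over the extended types supplies a witness \<open>w\<close>. Replacing
  \<open>Star\<close> by default values sends \<open>w\<close> to an element over the original
  product, whose projections are equivalent to \<open>x\<close> and \<open>y\<close> by
  \<open>map_sim\<close>.\<close>

lemma rel_class_witness: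
  assumes T: "is_types A" "is_types B" and R: "rels_between A B R" and xF: "x \<in> F A" and yF: "y \<in> F B"
    and xy: "rel_class A B R x y"
  obtains z where "z \<in> F (prod_types A B)"
    "\<And>i. set_class (prod_types A B) i z \<subseteq> {Pr a b | a b. (a, b) \<in> R i}"
    "(mapF (prod_types A B) A (\<lambda>i. fst_univ) z, x) \<in> sim A"
    "(mapF (prod_types A B) B (\<lambda>i. snd_univ) z, y) \<in> sim B"
proof -
  let ?A = "one_plus A" and ?B = "one_plus B" and ?AB = "prod_types A B"
  \<comment> \<open>The witness lives over the product of the extended types, not over the extension
    of the product.\<close>
  let ?P = "prod_types ?A ?B"
  note T' = is_types_one_plus[of A] is_types_one_plus[of B]
  note R' = rels_between_rel_one_plus[OF R]
  note P = is_types_prod_types[OF T'] and AB = is_types_prod_types[OF T]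
  obtain u v where uv: "(mapF A ?A (\<lambda>i. Emb) x, u) \<in> sim ?A"
    "(u, v) \<in> relF ?A ?B (\<lambda>i. rel_one_plus (R i))" "(v, mapF B ?B (\<lambda>i. Emb) y) \<in> sim ?B"
    using xy by (auto simp: rel_class_def)
  obtain w where w: "w \<in> F ?P"
    "\<And>i. setF ?P i w \<subseteq> {Pr a b | a b. (a, b) \<in> rel_one_plus (R i)}"
    "mapF ?P ?A (\<lambda>i. fst_univ) w = u" "mapF ?P ?B (\<lambda>i. snd_univ) w = v"
    by (rule rel_witness[OF T' R' uv(2)]) (rule that; blast)
  \<comment> \<open>The defaults are chosen jointly: when \<open>R i\<close> is nonempty they form a
    pair in \<open>R i\<close>, so that an atom \<open>Pr Star Star\<close> of \<open>w\<close> is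
    also sent into \<open>R i\<close>.\<close>
  have "\<exists>a b. a \<in> A i \<and> b \<in> B i \<and> (R i \<noteq> {} \<longrightarrow> (a, b) \<in> R i)" for i
  proof (cases "R i = {}")
    case True
    then show ?thesis using T by (auto simp: is_types_def ex_in_conv)
  next
    case False
    then show ?thesis using R by (fastforce simp: rels_between_def)
  qed
  then obtain c d where c: "\<And>i. c i \<in> A i" and d: "\<And>i. d i \<in> B i"
    and cd: "\<And>i. R i \<noteq> {} \<Longrightarrow> (c i, d i) \<in> R i" by metis
  note fc = funs_between_from_one_plus[where A = A and c = c, OF c]
  note fd = funs_between_from_one_plus[where A = B and c = d, OF d]
  define h where "h = (\<lambda>i p. Pr (from_one_plus (c i) (fst_univ p)) (from_one_plus (d i) (snd_univ p)))"
  have h: "funs_between ?P ?AB h"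
    using fc fd by (fastforce simp: funs_between_def prod_types_def h_def)
  define z where "z = mapF ?P ?AB h w"
  have z: "z \<in> F ?AB" unfolding z_def by (rule map_type[OF P AB h w(1)])
  \<comment> \<open>Projecting after \<open>h\<close> equals projecting first and then removing the
    extra point, so this is an image of \<open>u\<close>, which is equivalent to the embedded
    \<open>x\<close>.\<close>
  have "mapF ?AB A (\<lambda>i. fst_univ) z = mapF ?A A (\<lambda>i. from_one_plus (c i)) u"
    unfolding z_def w(3)[symmetric] map_comp[OF P AB T(1) h funs_between_fst_univ w(1)]
      map_comp[OF P T'(1) T(1) funs_between_fst_univ fc w(1)]
    by (simp add: h_def comp_def)
  then have zx: "(mapF ?AB A (\<lambda>i. fst_univ) z, x) \<in> sim A"
    using sim_sym[OF T(1) map_sim[OF T'(1) T(1) fc uv(1)]] from_one_plus_map_Emb[OF T(1) xF c]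
    by simp
  have "mapF ?AB B (\<lambda>i. snd_univ) z = mapF ?B B (\<lambda>i. from_one_plus (d i)) v"
    unfolding z_def w(4)[symmetric] map_comp[OF P AB T(2) h funs_between_snd_univ w(1)]
      map_comp[OF P T'(2) T(2) funs_between_snd_univ fd w(1)]
    by (simp add: h_def comp_def)
  then have zy: "(mapF ?AB B (\<lambda>i. snd_univ) z, y) \<in> sim B"
    using map_sim[OF T'(2) T(2) fd uv(3)] from_one_plus_map_Emb[OF T(2) yF d] by simp
  \<comment> \<open>If \<open>R i = {}\<close>, the default values may occur in \<open>setF ?AB i z\<close>, but not in every representative:
    the atoms of \<open>z\<close> project onto those of \<open>x\<close>, of which there are none.\<close>
  have "set_class ?AB i z \<subseteq> {Pr a b | a b. (a, b) \<in> R i}" for i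
  proof (cases "R i = {}")
    case True
    have "setF ?A i u \<subseteq> {Star}"
      using set_subset_Domain[OF T' R' uv(2), of i] True by (auto simp: rel_one_plus_def)
    then have "set_class A i x = {}" using uv(1) by (auto simp: set_class_def)
    moreover have "fst_univ ` set_class ?AB i z = set_class A i x"
      using set_class_map[OF AB T(1) funs_between_fst_univ z] set_class_sim[OF T(1) zx] by simp
    ultimately show ?thesis by simp
  next
    case False
    have "setF ?AB i z \<subseteq> {Pr a b | a b. (a, b) \<in> R i}"
      using w(2)[of i] cd[OF False] unfolding z_def set_map[OF P AB h w(1)]
      by (fastforce simp: h_def rel_one_plus_def)
    then show ?thesis using set_class_subset[OF AB z] by blast
  qed
  with z zx zy that show ?thesis by blast
qed

section \<open>Lifting to equivalence classes and the BNF axioms\<close>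

definition Q :: "('n, 'a) types \<Rightarrow> 'x set set" where
  "Q A = F A // sim A"

text \<open>No representative is chosen: the images of all members are closed under
  \<open>sim\<close>. Likewise \<open>setQ\<close> takes a union over all members, on which
  \<open>set_class\<close> is constant, and \<open>relQ\<close> quantifies over
  representatives.\<close>

definition mapQ ::
  "('n, 'a) types \<Rightarrow> ('n, 'a) types \<Rightarrow> ('n \<Rightarrow> 'a univ \<Rightarrow> 'a univ) \<Rightarrow> 'x set \<Rightarrow> 'x set" where
  "mapQ A B f X = sim B `` (mapF A B f ` X)"

definition setQ :: "('n, 'a) types \<Rightarrow> 'n \<Rightarrow> 'x set \<Rightarrow> 'a univ set" where
  "setQ A i X = (\<Union>x\<in>X. set_class A i x)"

definition relQ :: "('n, 'a) types \<Rightarrow> ('n, 'a) types \<Rightarrow> ('n \<Rightarrow> 'a univ rel) \<Rightarrow> 'x set rel" where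
  "relQ A B R = {(sim A `` {x}, sim B `` {y}) | x y. x \<in> F A \<and> y \<in> F B \<and> rel_class A B R x y}"

lemma Q_cases:
  assumes "X \<in> Q A"
  obtains x where "x \<in> F A" "X = sim A `` {x}"
  using assms unfolding Q_def by (rule quotientE) auto

lemma class_in_Q: "x \<in> F A \<Longrightarrow> sim A `` {x} \<in> Q A"
  unfolding Q_def by (rule quotientI)

lemma mapQ_class:
  assumes "is_types A" "is_types B" "funs_between A B f" "x \<in> F A"
  shows "mapQ A B f (sim A `` {x}) = sim B `` {mapF A B f x}"
  using map_sim[OF assms(1-3)] sim_trans[OF assms(2)] sim_refl[OF assms(1,4)]
  unfolding mapQ_def by blast

lemma setQ_class:
  assumes "is_types A" "x \<in> F A"
  shows "setQ A i (sim A `` {x}) = set_class A i x"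
  using set_class_sim[OF assms(1)] sim_refl[OF assms] unfolding setQ_def by blast

lemma relQ_class:
  assumes "is_types A" "is_types B" "x \<in> F A" "y \<in> F B"
  shows "(sim A `` {x}, sim B `` {y}) \<in> relQ A B R \<longleftrightarrow> rel_class A B R x y"
proof
  assume "(sim A `` {x}, sim B `` {y}) \<in> relQ A B R"
  then obtain x' y' where *: "sim A `` {x} = sim A `` {x'}" "sim B `` {y} = sim B `` {y'}"
    "x' \<in> F A" "y' \<in> F B" "rel_class A B R x' y'"
    by (auto simp: relQ_def)
  with assms have "(x', x) \<in> sim A" "(y', y) \<in> sim B"
    using class_eq_iff by metis+
  then show "rel_class A B R x y" using rel_class_sim assms(1,2) *(5) by blast
qed (use assms in \<open>auto simp: relQ_def\<close>)

text \<open>\<open>Q_cases\<close> reduces each axiom to the corresponding fact about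
  representatives. The bound \<open>bdF\<close> carries over since \<open>set_class\<close> only
  removes atoms.\<close>

lemma nary_bnf_Q: "nary_bnf Q mapQ setQ bdF relQ"
proof
  show "Q A \<noteq> {}" if "is_types A" for A
    using inhabited[OF that] class_in_Q by blast
  show "mapQ A B f X \<in> Q B"
    if "is_types A" "is_types B" "funs_between A B f" "X \<in> Q A" for A B f X
    using that(4) by (rule Q_cases) (simp add: mapQ_class that(1-3) class_in_Q map_type)
  show "setQ A i X \<subseteq> A i" if "is_types A" "X \<in> Q A" for A i X
    using that(2)
    by (rule Q_cases) (use set_class_subset[OF that(1)] set_type[OF that(1)] in
        \<open>fastforce simp: setQ_class that(1)\<close>)
  show "relQ A B R \<subseteq> Q A \<times> Q B" for A B R
    by (auto simp: relQ_def class_in_Q)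
  show "mapQ A A (\<lambda>i. id) X = X" if "is_types A" "X \<in> Q A" for A X
    using that(2) by (rule Q_cases) (simp add: mapQ_class that(1) funs_between_id map_id)
  show "mapQ B C g (mapQ A B f X) = mapQ A C (\<lambda>i. g i \<circ> f i) X"
    if "is_types A" "is_types B" "is_types C" "funs_between A B f" "funs_between B C g" "X \<in> Q A"
    for A B C f g X
    using that(6)
    by (rule Q_cases)
      (simp add: mapQ_class that(1-5) map_type[OF that(1,2,4)] funs_between_comp[OF that(4,5)]
        map_comp[OF that(1-5)])
  show "setQ B i (mapQ A B f X) = f i ` setQ A i X"
    if "is_types A" "is_types B" "funs_between A B f" "X \<in> Q A" for A B f X i
    using that(4)
    by (rule Q_cases)
      (simp add: mapQ_class setQ_class that(1-3) map_type[OF that(1-3)] set_class_map[OF that(1-3)])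
  show "mapQ A B f X = mapQ A B g X"
    if "is_types A" "is_types B" "funs_between A B f" "funs_between A B g" "X \<in> Q A"
      "\<forall>i. \<forall>z\<in>setQ A i X. f i z = g i z" for A B f g X
    using that(5)
  proof (rule Q_cases)
    fix x assume x: "x \<in> F A" "X = sim A `` {x}"
    have "(mapF A B f x, mapF A B g x) \<in> sim B"
      by (rule map_sim_cong[OF that(1-4) x(1)]) (use that(6) x setQ_class[OF that(1)] in auto)
    then show ?thesis
      using equiv_class_eq[OF equiv_sim[OF that(2)]] by (simp add: x mapQ_class that(1-4))
  qed
  show "Card_order bdF" by (rule bd_Card_order)
  show "cinfinite bdF" by (rule bd_cinfinite)
  show "|setQ A i X| \<le>o bdF" if "is_types A" "X \<in> Q A" for A i X
    using that(2)
  proof (rule Q_cases)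
    fix x assume x: "x \<in> F A" "X = sim A `` {x}"
    show ?thesis
      unfolding x(2) setQ_class[OF that(1) x(1)]
      by (rule ordLeq_transitive[OF card_of_mono1[OF set_class_subset[OF that(1) x(1)]]
            set_bd[OF that(1) x(1)]])
  qed
  show "(X, Y) \<in> relQ A B R \<longleftrightarrow>
      (\<exists>Z\<in>Q (prod_types A B).
        (\<forall>i. setQ (prod_types A B) i Z \<subseteq> {Pr a b | a b. (a, b) \<in> R i}) \<and>
        mapQ (prod_types A B) A (\<lambda>i. fst_univ) Z = X \<and>
        mapQ (prod_types A B) B (\<lambda>i. snd_univ) Z = Y)" (is "_ \<longleftrightarrow> ?witness")
    if T: "is_types A" "is_types B" and R: "rels_between A B R" and XY: "X \<in> Q A" "Y \<in> Q B"
    for A B R X Y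
  proof -
    obtain x where x: "x \<in> F A" "X = sim A `` {x}" using XY(1) by (rule Q_cases)
    obtain y where y: "y \<in> F B" "Y = sim B `` {y}" using XY(2) by (rule Q_cases)
    note P = is_types_prod_types[OF T]
    note fst = funs_between_fst_univ[of A B] and snd = funs_between_snd_univ[of A B]
    show ?thesis
    proof
      assume "(X, Y) \<in> relQ A B R"
      then have "rel_class A B R x y" by (simp add: x y relQ_class T)
      then obtain z where z: "z \<in> F (prod_types A B)"
        "\<And>i. set_class (prod_types A B) i z \<subseteq> {Pr a b | a b. (a, b) \<in> R i}"
        "(mapF (prod_types A B) A (\<lambda>i. fst_univ) z, x) \<in> sim A"
        "(mapF (prod_types A B) B (\<lambda>i. snd_univ) z, y) \<in> sim B"
        by (rule rel_class_witness[OF T R x(1) y(1)]) (rule that; blast)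
      show ?witness
        by (rule bexI[OF _ class_in_Q[OF z(1)]])
          (use z x y equiv_class_eq[OF equiv_sim] in
            \<open>simp add: setQ_class[OF P] mapQ_class[OF P] T fst snd\<close>)
    next
      assume ?witness
      then obtain z where z: "z \<in> F (prod_types A B)"
        "\<And>i. set_class (prod_types A B) i z \<subseteq> {Pr a b | a b. (a, b) \<in> R i}"
        "X = sim A `` {mapF (prod_types A B) A (\<lambda>i. fst_univ) z}"
        "Y = sim B `` {mapF (prod_types A B) B (\<lambda>i. snd_univ) z}"
        by (auto elim!: Q_cases simp: setQ_class[OF P] mapQ_class[OF P] T fst snd)
      show "(X, Y) \<in> relQ A B R"
        unfolding z(3,4)
        using rel_class_if_witness[OF T R z(1,2)] map_type[OF P T(1) fst z(1)] map_type[OF P T(2) snd z(1)]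
        by (simp add: relQ_class T)
    qed
  qed
  show "relQ A B R O relQ B C S \<subseteq> relQ A C (\<lambda>i. R i O S i)"
    if T: "is_types A" "is_types B" "is_types C" and RS: "rels_between A B R" "rels_between B C S"
    for A B C R S
  proof clarify
    fix X Y Z assume XYZ: "(X, Y) \<in> relQ A B R" "(Y, Z) \<in> relQ B C S"
    then have "X \<in> Q A" "Y \<in> Q B" "Z \<in> Q C" by (auto simp: relQ_def class_in_Q)
    then obtain x y z where
      *: "X = sim A `` {x}" "Y = sim B `` {y}" "Z = sim C `` {z}" "x \<in> F A" "y \<in> F B" "z \<in> F C"
      by (metis Q_cases)
    from XYZ have "rel_class A B R x y" "rel_class B C S y z" by (simp_all add: * relQ_class T)
    then show "(X, Z) \<in> relQ A C (\<lambda>i. R i O S i)"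
      using rel_class_trans[OF T RS] by (simp add: * relQ_class T)
  qed
qed

end

theorem theorem3p19:
  fixes F :: "('n::finite, 'a) types \<Rightarrow> 'x set"
    and mapF :: "('n, 'a) types \<Rightarrow> ('n, 'a) types \<Rightarrow> ('n \<Rightarrow> 'a univ \<Rightarrow> 'a univ) \<Rightarrow> 'x \<Rightarrow> 'x"
    and setF :: "('n, 'a) types \<Rightarrow> 'n \<Rightarrow> 'x \<Rightarrow> 'a univ set"
    and bdF :: "'k rel"
    and relF :: "('n, 'a) types \<Rightarrow> ('n, 'a) types \<Rightarrow> ('n \<Rightarrow> 'a univ rel) \<Rightarrow> 'x rel"
    and sim :: "('n, 'a) types \<Rightarrow> 'x rel"
  assumes bnf_F: "nary_bnf F mapF setF bdF relF"
    and E: "\<And>T. is_types T \<Longrightarrow> equiv (F T) (sim T)"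
    and WI: "\<And>T (\<A> :: 'n \<Rightarrow> 'a univ set set).
      \<lbrakk>is_types T; \<And>i. \<A> i \<subseteq> Pow (T i); \<And>i. \<A> i \<noteq> {}; \<And>i. \<Inter>(\<A> i) \<noteq> {}\<rbrakk> \<Longrightarrow>
      \<Inter>{F_in F setF T A // sim T | A. \<forall>i. A i \<in> \<A> i}
        \<subseteq> \<Inter>{F_in F setF T A | A. \<forall>i. A i \<in> \<A> i} // sim T"
    and WP: "\<And>A B C R S.
      \<lbrakk>is_types A; is_types B; is_types C; rels_between A B R; rels_between B C S;
        \<And>i. R i O S i \<noteq> {}\<rbrakk> \<Longrightarrow>
      relF A B R O sim B O relF B C S \<subseteq> sim A O relF A C (\<lambda>i. R i O S i) O sim C"
  shows "\<exists>mapQ setQ (bdQ :: 'k rel) relQ.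
    nary_bnf (\<lambda>T. F T // sim T) mapQ setQ bdQ relQ \<and>
    (\<forall>A B f x. is_types A \<and> is_types B \<and> funs_between A B f \<and> x \<in> F A \<longrightarrow>
      mapQ A B f (sim A `` {x}) = sim B `` {mapF A B f x}) \<and>
    (\<forall>A i x. is_types A \<and> x \<in> F A \<longrightarrow>
      setQ A i (sim A `` {x}) =
        (\<Inter>y \<in> sim (one_plus A) `` {mapF A (one_plus A) (\<lambda>i. Emb) x}.
          {a. Emb a \<in> setF (one_plus A) i y})) \<and>
    (\<forall>A B R x y. is_types A \<and> is_types B \<and> rels_between A B R \<and> x \<in> F A \<and> y \<in> F B \<longrightarrow>
      (sim A `` {x}, sim B `` {y}) \<in> relQ A B R \<longleftrightarrow>
      (mapF A (one_plus A) (\<lambda>i. Emb) x, mapF B (one_plus B) (\<lambda>i. Emb) y)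
        \<in> sim (one_plus A) O relF (one_plus A) (one_plus B) (\<lambda>i. rel_one_plus (R i)) O sim (one_plus B))"
proof -
  interpret nary_bnf_quotient F mapF setF bdF relF sim
    unfolding nary_bnf_quotient_def nary_bnf_quotient_axioms_def
    using bnf_F E WI WP by blast
  have "nary_bnf (\<lambda>T. F T // sim T) mapQ setQ bdF relQ"
    using nary_bnf_Q unfolding Q_def[abs_def] .
  then show ?thesis
    using mapQ_class setQ_class[unfolded set_class_def] relQ_class[unfolded rel_class_def]
    by (intro exI[of _ mapQ] exI[of _ setQ] exI[of _ bdF] exI[of _ relQ]) simp
qed

end
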